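(* For the $n$-sided antiprism graph $A_n$ on $2n$ vertices ($n\ge3$), with its standard plane embedding, $\pi_{fl}(A_n)\le 7$.
   Context: The $n$-sided antiprism graph $A_n$ has vertices $v_1,\dots,v_n,u_1,\dots,u_n$ and $4n$ edges: the two $n$-cycles $v_1\dots v_n$ and $u_1\dots u_n$, together with edges $u_1v_1,u_1v_n$ and $u_iv_i,u_iv_{i-1}$ for $i=2,\dots,n$; its standard plane embedding has two $n$-gonal faces (bounded by the two cycles) and $2n$ triangular faces. A sequence $r_1\dots r_{2n}$ is a repetition if $r_i=r_{n+i}$ for all $i\le n$. In a plane graph $G$, a facial path is a path whose vertices and edges are consecutive on the boundary walk of some face of $G$. A vertex colouring is facial non-repetitive if no facial path on vertices $v_1,\dots,v_{2n}$ ($n\ge1$) has colour sequence that is a repetition. $\pi_{fl}(G)$ is the minimum $l$ such that for every assignment of lists $L(v)\subseteq\mathbb{Z}_+$ with $|L(v)|\ge l$ there is a facial non-repetitive colouring $\varphi$ with $\varphi(v)\in L(v)$ for every vertex $v$. *)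

theory Defs
  imports
    "Graph_Theory.Graph_Theory"
    "HOL-Combinatorics.Orbits"
    "HOL-Library.Extended_Nat"
begin

section \<open>Plane graphs\<close>

text \<open>
  An embedding of a finite connected simple graph with at least one edge is given by a
  rotation system: \<open>rot v w\<close> is
  the neighbour of \<open>v\<close> that follows \<open>w\<close> in the cyclic order around \<open>v\<close>. The boundary walks
  of the faces are the orbits of \<open>face_succ\<close> on the arcs (the two orientations of the edges),
  each arc lying on exactly one of them. The embedding is in the plane (equivalently, the
  sphere) iff its Euler characteristic is 2.
\<close>

definition face_succ :: "('a \<Rightarrow> 'a \<Rightarrow> 'a) \<Rightarrow> 'a \<times> 'a \<Rightarrow> 'a \<times> 'a" where
  "face_succ rot = (\<lambda>(u, v). (v, rot v u))"

definition faces :: "'a pair_pre_digraph \<Rightarrow> ('a \<Rightarrow> 'a \<Rightarrow> 'a) \<Rightarrow> ('a \<times> 'a) set set" where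
  "faces G rot = orbit (face_succ rot) ` parcs G"

locale plane_graph = pair_graph G for G :: "'a pair_pre_digraph" +
  fixes rot :: "'a \<Rightarrow> 'a \<Rightarrow> 'a"
  assumes rotation: "\<And>v. v \<in> pverts G \<Longrightarrow> cyclic_on (rot v) {w. (v, w) \<in> parcs G}"
    and connected: "Digraph_Component.connected (with_proj G)"
    and euler: "int (card (pverts G)) - int (card (parcs G) div 2) + int (card (faces G rot)) = 2"

text \<open>
  A path occurring as a block of consecutive vertices on the boundary walk of a face. The walk
  is traced from one of its arcs \<open>a\<close>; the path may run along it or against it.
\<close>

definition facial_path :: "'a pair_pre_digraph \<Rightarrow> ('a \<Rightarrow> 'a \<Rightarrow> 'a) \<Rightarrow> 'a list \<Rightarrow> bool" where
  "facial_path G rot p \<longleftrightarrow> vpath p (with_proj G) \<and>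
     (\<exists>a \<in> parcs G. \<exists>q \<in> {p, rev p}.
        q = map (\<lambda>k. fst ((face_succ rot ^^ k) a)) [0..<length p])"

section \<open>Facial non-repetitive list colouring\<close>

definition repetition :: "'c list \<Rightarrow> bool" where
  "repetition r \<longleftrightarrow> (\<exists>n\<ge>1. length r = 2 * n \<and> (\<forall>i<n. r ! i = r ! (n + i)))"

definition facial_nonrepetitive ::
    "'a pair_pre_digraph \<Rightarrow> ('a \<Rightarrow> 'a \<Rightarrow> 'a) \<Rightarrow> ('a \<Rightarrow> 'c) \<Rightarrow> bool" where
  "facial_nonrepetitive G rot \<phi> \<longleftrightarrow> \<not> (\<exists>p. facial_path G rot p \<and> repetition (map \<phi> p))"

text \<open>Lists may be infinite; \<open>card\<close> would assign such a list the size 0.\<close>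

definition facial_nonrepetitively_choosable ::
    "'a pair_pre_digraph \<Rightarrow> ('a \<Rightarrow> 'a \<Rightarrow> 'a) \<Rightarrow> nat \<Rightarrow> bool" where
  "facial_nonrepetitively_choosable G rot l \<longleftrightarrow>
     (\<forall>L :: 'a \<Rightarrow> nat set.
        (\<forall>v \<in> pverts G. L v \<subseteq> {0<..} \<and> (infinite (L v) \<or> l \<le> card (L v))) \<longrightarrow>
        (\<exists>\<phi>. facial_nonrepetitive G rot \<phi> \<and> (\<forall>v \<in> pverts G. \<phi> v \<in> L v)))"

text \<open>In \<^typ>\<open>enat\<close>, so that the value would be \<open>\<infinity>\<close> if no list size sufficed.\<close>

definition pi_fl :: "'a pair_pre_digraph \<Rightarrow> ('a \<Rightarrow> 'a \<Rightarrow> 'a) \<Rightarrow> enat" where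
  "pi_fl G rot = (INF l \<in> {l. facial_nonrepetitively_choosable G rot l}. enat l)"

section \<open>The antiprism\<close>

datatype antiprism_vertex = Pv nat | Pu nat

definition antiprism_verts :: "nat \<Rightarrow> antiprism_vertex set" where
  "antiprism_verts n = Pv ` {1..n} \<union> Pu ` {1..n}"

definition antiprism_edges :: "nat \<Rightarrow> antiprism_vertex set set" where
  "antiprism_edges n =
     {{Pv i, Pv (i + 1)} | i. 1 \<le> i \<and> i < n} \<union> {{Pv n, Pv 1}} \<union>
     {{Pu i, Pu (i + 1)} | i. 1 \<le> i \<and> i < n} \<union> {{Pu n, Pu 1}} \<union>
     {{Pu 1, Pv 1}, {Pu 1, Pv n}} \<union>
     {{Pu i, Pv i} | i. 2 \<le> i \<and> i \<le> n} \<union>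
     {{Pu i, Pv (i - 1)} | i. 2 \<le> i \<and> i \<le> n}"

definition antiprism :: "nat \<Rightarrow> antiprism_vertex pair_pre_digraph" where
  "antiprism n = \<lparr> pverts = antiprism_verts n, parcs = {(x, y). {x, y} \<in> antiprism_edges n} \<rparr>"

definition cyc_suc :: "nat \<Rightarrow> nat \<Rightarrow> nat" where
  "cyc_suc n i = (if i = n then 1 else i + 1)"

definition cyc_pred :: "nat \<Rightarrow> nat \<Rightarrow> nat" where
  "cyc_pred n i = (if i = 1 then n else i - 1)"

text \<open>
  The standard drawing has the cycle of the \<open>v\<close>'s outside, the cycle of the \<open>u\<close>'s inside, both
  counterclockwise, and \<open>u\<^sub>i\<close> between \<open>v\<^sub>i\<^sub>-\<^sub>1\<close> and \<open>v\<^sub>i\<close>. Counterclockwise, the neighbours of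
  \<open>v\<^sub>i\<close> are \<open>v\<^sub>i\<^sub>+\<^sub>1, u\<^sub>i\<^sub>+\<^sub>1, u\<^sub>i, v\<^sub>i\<^sub>-\<^sub>1\<close> and those of \<open>u\<^sub>i\<close> are \<open>u\<^sub>i\<^sub>-\<^sub>1, v\<^sub>i\<^sub>-\<^sub>1, v\<^sub>i, u\<^sub>i\<^sub>+\<^sub>1\<close>.
\<close>

fun antiprism_rot :: "nat \<Rightarrow> antiprism_vertex \<Rightarrow> antiprism_vertex \<Rightarrow> antiprism_vertex" where
  "antiprism_rot n (Pv i) w =
     (if w = Pv (cyc_suc n i) then Pu (cyc_suc n i)
      else if w = Pu (cyc_suc n i) then Pu i
      else if w = Pu i then Pv (cyc_pred n i)
      else Pv (cyc_suc n i))"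
| "antiprism_rot n (Pu i) w =
     (if w = Pu (cyc_pred n i) then Pv (cyc_pred n i)
      else if w = Pv (cyc_pred n i) then Pv i
      else if w = Pv i then Pu (cyc_suc n i)
      else Pu (cyc_pred n i))"

section \<open>The antiprism is a plane graph with the expected faces\<close>

lemma cyc_suc_in: "n \<ge> 3 \<Longrightarrow> i \<in> {1..n} \<Longrightarrow> cyc_suc n i \<in> {1..n}"
  and cyc_pred_in: "n \<ge> 3 \<Longrightarrow> i \<in> {1..n} \<Longrightarrow> cyc_pred n i \<in> {1..n}"
  and cyc_pred_suc: "n \<ge> 3 \<Longrightarrow> i \<in> {1..n} \<Longrightarrow> cyc_pred n (cyc_suc n i) = i"
  and cyc_suc_pred: "n \<ge> 3 \<Longrightarrow> i \<in> {1..n} \<Longrightarrow> cyc_suc n (cyc_pred n i) = i"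
  and cyc_suc_neq: "n \<ge> 3 \<Longrightarrow> i \<in> {1..n} \<Longrightarrow> cyc_suc n i \<noteq> i"
  and cyc_pred_neq: "n \<ge> 3 \<Longrightarrow> i \<in> {1..n} \<Longrightarrow> cyc_pred n i \<noteq> i"
  and cyc_pred_neq_suc: "n \<ge> 3 \<Longrightarrow> i \<in> {1..n} \<Longrightarrow> cyc_pred n i \<noteq> cyc_suc n i"
  by (auto simp: cyc_suc_def cyc_pred_def)

lemmas cyc_simps =
  cyc_suc_in cyc_pred_in cyc_pred_suc cyc_suc_pred cyc_suc_neq cyc_pred_neq cyc_pred_neq_suc
  cyc_suc_neq[symmetric] cyc_pred_neq[symmetric] cyc_pred_neq_suc[symmetric]

lemma pverts_antiprism: "pverts (antiprism n) = Pv ` {1..n} \<union> Pu ` {1..n}"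
  by (simp add: antiprism_def antiprism_verts_def)

lemma antiprism_edges_eq:
  assumes "n \<ge> 3"
  shows "antiprism_edges n =
    (\<Union>i\<in>{1..n}. {{Pv i, Pv (cyc_suc n i)}, {Pu i, Pu (cyc_suc n i)},
                   {Pu i, Pv i}, {Pu (cyc_suc n i), Pv i}})" (is "?L = ?R")
proof
  show "?L \<subseteq> ?R"
  proof
    fix e assume "e \<in> ?L"
    then consider (a) i where "1 \<le> i" "i < n" "e = {Pv i, Pv (i+1)}" | (b) "e = {Pv n, Pv 1}"
      | (c) i where "1 \<le> i" "i < n" "e = {Pu i, Pu (i+1)}" | (d) "e = {Pu n, Pu 1}"
      | (e) i where "2 \<le> i" "i \<le> n" "e = {Pu i, Pv i}"
      | (e1) "e = {Pu 1, Pv 1}" | (f) "e = {Pu 1, Pv n}"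
      | (g) i where "2 \<le> i" "i \<le> n" "e = {Pu i, Pv (i - 1)}"
      unfolding antiprism_edges_def Un_iff mem_Collect_eq insert_iff empty_iff
      by (elim disjE exE conjE FalseE) (rule that; assumption)+
    then show "e \<in> ?R"
    proof cases
      case a then show ?thesis by (intro UN_I[of i]) (simp_all add: cyc_suc_def)
    next
      case b then show ?thesis using assms by (intro UN_I[of n]) (simp_all add: cyc_suc_def)
    next
      case c then show ?thesis by (intro UN_I[of i]) (simp_all add: cyc_suc_def)
    next
      case d then show ?thesis using assms by (intro UN_I[of n]) (simp_all add: cyc_suc_def)
    next
      case e then show ?thesis by (intro UN_I[of i]) simp_all
    next
      case e1 then show ?thesis using assms by (intro UN_I[of 1]) simp_all
    next
      case f then show ?thesis using assms by (intro UN_I[of n]) (simp_all add: cyc_suc_def)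
    next
      case g
      then have "i - 1 \<in> {1..n}" "cyc_suc n (i - 1) = i" by (auto simp: cyc_suc_def)
      then show ?thesis using g by (intro UN_I[of "i - 1"]) simp_all
    qed
  qed
next
  have "{Pv i, Pv (cyc_suc n i)} \<in> ?L" "{Pu i, Pu (cyc_suc n i)} \<in> ?L"
    "{Pu i, Pv i} \<in> ?L" "{Pu (cyc_suc n i), Pv i} \<in> ?L" if i: "i \<in> {1..n}" for i
  proof -
    have a: "{Pv i, Pv (i + 1)} \<in> ?L" "{Pu i, Pu (i + 1)} \<in> ?L" if "1 \<le> i" "i < n" for i
    proof -
      show "{Pv i, Pv (i + 1)} \<in> ?L" unfolding antiprism_edges_def
        by (rule UnI1, rule UnI1, rule UnI1, rule UnI1, rule UnI1, rule UnI1)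
          (intro CollectI exI[of _ i] conjI refl that)
      show "{Pu i, Pu (i + 1)} \<in> ?L" unfolding antiprism_edges_def
        by (rule UnI1, rule UnI1, rule UnI1, rule UnI1, rule UnI2)
          (intro CollectI exI[of _ i] conjI refl that)
    qed
    have b: "{Pv n, Pv 1} \<in> ?L" "{Pu n, Pu 1} \<in> ?L" "{Pu 1, Pv 1} \<in> ?L" "{Pu 1, Pv n} \<in> ?L"
      unfolding antiprism_edges_def Un_iff insert_iff by simp_all
    have c: "{Pu i, Pv i} \<in> ?L" "{Pu i, Pv (i - 1)} \<in> ?L" if "2 \<le> i" "i \<le> n" for i
    proof -
      show "{Pu i, Pv i} \<in> ?L" unfolding antiprism_edges_def
        by (rule UnI1, rule UnI2) (intro CollectI exI[of _ i] conjI refl that)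
      show "{Pu i, Pv (i - 1)} \<in> ?L" unfolding antiprism_edges_def
        by (rule UnI2) (intro CollectI exI[of _ i] conjI refl that)
    qed
    show "{Pv i, Pv (cyc_suc n i)} \<in> ?L" "{Pu i, Pu (cyc_suc n i)} \<in> ?L"
      using i a[of i] b by (cases "i = n"; simp add: cyc_suc_def)+
    show "{Pu i, Pv i} \<in> ?L"
      using i b c[of i] by (cases "i = 1") simp_all
    show "{Pu (cyc_suc n i), Pv i} \<in> ?L"
      using i b c[of "i + 1"] by (cases "i = n") (simp_all add: cyc_suc_def)
  qed
  then show "?R \<subseteq> ?L" by blast
qed

lemma antiprism_arc_iff:
  assumes "n \<ge> 3"
  shows "(x, y) \<in> parcs (antiprism n) \<longleftrightarrow> (\<exists>i\<in>{1..n}. (x, y) \<in>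
    {(Pv i, Pv (cyc_suc n i)), (Pv (cyc_suc n i), Pv i),
     (Pu i, Pu (cyc_suc n i)), (Pu (cyc_suc n i), Pu i), (Pu i, Pv i), (Pv i, Pu i),
     (Pu (cyc_suc n i), Pv i), (Pv i, Pu (cyc_suc n i))})"
proof -
  have "{x, y} \<in> {{Pv i, Pv (cyc_suc n i)}, {Pu i, Pu (cyc_suc n i)},
               {Pu i, Pv i}, {Pu (cyc_suc n i), Pv i}} \<longleftrightarrow> (x, y) \<in>
    {(Pv i, Pv (cyc_suc n i)), (Pv (cyc_suc n i), Pv i),
     (Pu i, Pu (cyc_suc n i)), (Pu (cyc_suc n i), Pu i), (Pu i, Pv i), (Pv i, Pu i),
     (Pu (cyc_suc n i), Pv i), (Pv i, Pu (cyc_suc n i))}" for i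
    unfolding insert_iff empty_iff doubleton_eq_iff prod.inject by blast
  then show ?thesis
    unfolding antiprism_def by (simp only: pair_pre_digraph.simps mem_Collect_eq case_prod_conv
      antiprism_edges_eq[OF assms] UN_iff)
qed

lemma antiprism_nbrs_v:
  assumes "n \<ge> 3" "i \<in> {1..n}"
  shows "{w. (Pv i, w) \<in> parcs (antiprism n)} =
    {Pv (cyc_suc n i), Pu (cyc_suc n i), Pu i, Pv (cyc_pred n i)}" (is "?L = ?R")
proof
  show "?L \<subseteq> ?R"
    using assms by (auto simp: antiprism_arc_iff cyc_simps)
  have "cyc_pred n i \<in> {1..n}" "cyc_suc n (cyc_pred n i) = i"
    using cyc_pred_in[OF assms] cyc_suc_pred[OF assms] by auto
  then have "Pv (cyc_pred n i) \<in> ?L"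
    unfolding mem_Collect_eq antiprism_arc_iff[OF assms(1)]
    by (intro bexI[of _ "cyc_pred n i"]; simp)+
  moreover have "Pv (cyc_suc n i) \<in> ?L" "Pu (cyc_suc n i) \<in> ?L" "Pu i \<in> ?L"
    unfolding mem_Collect_eq antiprism_arc_iff[OF assms(1)]
    using assms(2) by (intro bexI[of _ i]; simp)+
  ultimately show "?R \<subseteq> ?L" unfolding insert_subset by simp
qed

lemma antiprism_nbrs_u:
  assumes "n \<ge> 3" "i \<in> {1..n}"
  shows "{w. (Pu i, w) \<in> parcs (antiprism n)} =
    {Pu (cyc_pred n i), Pv (cyc_pred n i), Pv i, Pu (cyc_suc n i)}" (is "?L = ?R")
proof
  show "?L \<subseteq> ?R"
    using assms by (auto simp: antiprism_arc_iff cyc_simps)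
  have "cyc_pred n i \<in> {1..n}" "cyc_suc n (cyc_pred n i) = i"
    using cyc_pred_in[OF assms] cyc_suc_pred[OF assms] by auto
  then have "Pu (cyc_pred n i) \<in> ?L" "Pv (cyc_pred n i) \<in> ?L"
    unfolding mem_Collect_eq antiprism_arc_iff[OF assms(1)]
    by (intro bexI[of _ "cyc_pred n i"]; simp)+
  moreover have "Pv i \<in> ?L" "Pu (cyc_suc n i) \<in> ?L"
    unfolding mem_Collect_eq antiprism_arc_iff[OF assms(1)]
    using assms(2) by (intro bexI[of _ i]; simp)+
  ultimately show "?R \<subseteq> ?L" unfolding insert_subset by simp
qed

lemma pair_graph_antiprism:
  assumes "n \<ge> 3" shows "pair_graph (antiprism n)"
proof -
  let ?G = "antiprism n"
  have sub: "fst e \<in> pverts ?G \<and> snd e \<in> pverts ?G \<and> fst e \<noteq> snd e"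
    if "e \<in> parcs ?G" for e
  proof -
    obtain x y where e: "e = (x, y)" by (cases e)
    obtain i where i: "i \<in> {1..n}" and xy: "(x, y) \<in>
    {(Pv i, Pv (cyc_suc n i)), (Pv (cyc_suc n i), Pv i),
     (Pu i, Pu (cyc_suc n i)), (Pu (cyc_suc n i), Pu i), (Pu i, Pv i), (Pv i, Pu i),
     (Pu (cyc_suc n i), Pv i), (Pv i, Pu (cyc_suc n i))}"
      using \<open>e \<in> parcs ?G\<close> unfolding e antiprism_arc_iff[OF assms] by (rule bexE)
    have "Pv i \<in> pverts ?G" "Pu i \<in> pverts ?G"
      "Pv (cyc_suc n i) \<in> pverts ?G" "Pu (cyc_suc n i) \<in> pverts ?G"
      unfolding pverts_antiprism using i cyc_suc_in[OF assms i] by blast+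
    then show ?thesis
      using xy cyc_suc_neq[OF assms i] unfolding e by (elim insertE emptyE) auto
  qed
  have fin: "finite (pverts ?G)" by (simp add: pverts_antiprism)
  have "parcs ?G \<subseteq> pverts ?G \<times> pverts ?G"
    using sub by (auto simp: mem_Times_iff)
  then have "finite (parcs ?G)"
    using fin by (meson finite_SigmaI finite_subset)
  moreover have "sym (parcs ?G)"
    by (simp add: sym_def antiprism_def insert_commute)
  ultimately show ?thesis
    using sub fin by unfold_locales (simp_all add: symmetric_def)
qed

lemma card_verts_antiprism: "card (pverts (antiprism n)) = 2 * n"
  unfolding pverts_antiprism
  by (subst card_Un_disjoint) (auto simp: card_image inj_on_def)

lemma card_arcs_antiprism:
  assumes "n \<ge> 3" shows "card (parcs (antiprism n)) = 8 * n"
proof -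
  interpret pair_graph "antiprism n" by (rule pair_graph_antiprism[OF assms])
  have "parcs (antiprism n) =
      Sigma (pverts (antiprism n)) (\<lambda>v. {w. (v, w) \<in> parcs (antiprism n)})"
    by (auto dest: in_arcsD1)
  moreover have "card {w. (v, w) \<in> parcs (antiprism n)} = 4" if "v \<in> pverts (antiprism n)" for v
    using that assms by (auto simp: pverts_antiprism antiprism_nbrs_v antiprism_nbrs_u cyc_simps)
  moreover have "finite {w. (v, w) \<in> parcs (antiprism n)}" if "v \<in> pverts (antiprism n)" for v
    using that assms by (auto simp: pverts_antiprism antiprism_nbrs_v antiprism_nbrs_u)
  ultimately show ?thesis
    using pair_finite_verts card_SigmaI[of "pverts (antiprism n)" "\<lambda>v. {w. (v, w) \<in> parcs (antiprism n)}"]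
    by (simp add: card_verts_antiprism)
qed

lemma card_antiprism_edges:
  assumes "n \<ge> 3" shows "card (antiprism_edges n) = 4 * n"
proof -
  let ?E = "\<lambda>i. {{Pv i, Pv (cyc_suc n i)}, {Pu i, Pu (cyc_suc n i)},
                   {Pu i, Pv i}, {Pu (cyc_suc n i), Pv i}}"
  have "card (?E i) = 4" if "i \<in> {1..n}" for i
    using that assms cyc_suc_neq[OF assms that] by (simp add: doubleton_eq_iff)
  moreover have "?E i \<inter> ?E j = {}" if ij: "i \<in> {1..n}" "j \<in> {1..n}" "i \<noteq> j" for i j
  proof -
    have "cyc_suc n i \<noteq> cyc_suc n j" "\<not> (i = cyc_suc n j \<and> cyc_suc n i = j)"
      using ij assms by (auto simp: cyc_suc_def split: if_splits)
    then have "e \<notin> ?E j" if "e \<in> ?E i" for e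
      using that ij(3) by (elim insertE emptyE) (auto simp: doubleton_eq_iff)
    then show ?thesis by blast
  qed
  ultimately show ?thesis
    using card_UN_disjoint[of "{1..n}" ?E] by (simp add: antiprism_edges_eq[OF assms])
qed

lemma cyclic_onI_closed:
  assumes "s \<in> S" "\<And>x. x \<in> S \<Longrightarrow> f x \<in> S" "S \<subseteq> orbit f s"
  shows "cyclic_on f S"
proof (rule cyclic_on_singleI)
  have "x \<in> S" if "x \<in> orbit f s" for x
    using that by induction (use assms in auto)
  then show "S = orbit f s" using assms(3) by blast
qed fact

lemma cyclic_on_4:
  assumes "f a = b" "f b = c" "f c = d" "f d = a"
  shows "cyclic_on f {a, b, c, d}"
  using assms orbit.base[of f a] orbit.step[of b f a] orbit.step[of c f a] orbit.step[of d f a]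
  by (intro cyclic_onI_closed[of a]) auto

lemma cyclic_on_3:
  assumes "f a = b" "f b = c" "f c = a"
  shows "cyclic_on f {a, b, c}"
  using assms orbit.base[of f a] orbit.step[of b f a] orbit.step[of c f a]
  by (intro cyclic_onI_closed[of a]) auto

definition v_face :: "nat \<Rightarrow> (antiprism_vertex \<times> antiprism_vertex) set" where
  "v_face n = (\<lambda>i. (Pv i, Pv (cyc_suc n i))) ` {1..n}"

definition u_face :: "nat \<Rightarrow> (antiprism_vertex \<times> antiprism_vertex) set" where
  "u_face n = (\<lambda>i. (Pu (cyc_suc n i), Pu i)) ` {1..n}"

definition vvu_face :: "nat \<Rightarrow> nat \<Rightarrow> (antiprism_vertex \<times> antiprism_vertex) set" where
  "vvu_face n i = {(Pv (cyc_suc n i), Pv i), (Pv i, Pu (cyc_suc n i)),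
                   (Pu (cyc_suc n i), Pv (cyc_suc n i))}"

definition uuv_face :: "nat \<Rightarrow> nat \<Rightarrow> (antiprism_vertex \<times> antiprism_vertex) set" where
  "uuv_face n i = {(Pu i, Pu (cyc_suc n i)), (Pu (cyc_suc n i), Pv i), (Pv i, Pu i)}"

context
  fixes n :: nat
  assumes n: "n \<ge> 3"
begin

lemma cyclic_v_face: "cyclic_on (face_succ (antiprism_rot n)) (v_face n)"
proof (rule cyclic_onI_closed)
  let ?a = "(Pv n, Pv 1)"
  have step: "face_succ (antiprism_rot n) (Pv i, Pv (cyc_suc n i)) = (Pv (cyc_suc n i), Pv (cyc_suc n (cyc_suc n i)))"
    if "i \<in> {1..n}" for i
    using that n cyc_pred_neq_suc[of n "cyc_suc n i"] cyc_pred_suc[of n i] cyc_suc_in[of n i]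
    by (auto simp: face_succ_def)
  show "?a \<in> v_face n" using n by (auto simp: v_face_def cyc_suc_def intro!: image_eqI[of _ _ n])
  show "face_succ (antiprism_rot n) x \<in> v_face n" if "x \<in> v_face n" for x
  proof -
    from that obtain i where i: "i \<in> {1..n}" "x = (Pv i, Pv (cyc_suc n i))"
      by (auto simp: v_face_def)
    then show ?thesis
      unfolding i(2) step[OF i(1)] v_face_def using cyc_suc_in[OF n i(1)] by blast
  qed
  have "(Pv (Suc k), Pv (cyc_suc n (Suc k))) \<in> orbit (face_succ (antiprism_rot n)) ?a" if "k < n" for k
    using that
  proof (induction k)
    case 0
    then show ?case using step[of n] n orbit.base[of "face_succ (antiprism_rot n)" ?a] by (simp add: cyc_suc_def)
  next
    case (Suc k)
    then show ?case using step[of "Suc k"] orbit.step[OF Suc.IH] by (simp add: cyc_suc_def)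
  qed
  then have "(Pv i, Pv (cyc_suc n i)) \<in> orbit (face_succ (antiprism_rot n)) ?a" if "i \<in> {1..n}" for i
    using that by (cases i) auto
  then show "v_face n \<subseteq> orbit (face_succ (antiprism_rot n)) ?a" by (auto simp: v_face_def)
qed

lemma cyclic_u_face: "cyclic_on (face_succ (antiprism_rot n)) (u_face n)"
proof (rule cyclic_onI_closed)
  let ?a = "(Pu 1, Pu n)"
  have step: "face_succ (antiprism_rot n) (Pu (cyc_suc n i), Pu i) = (Pu i, Pu (cyc_pred n i))" if "i \<in> {1..n}" for i
    using that n cyc_pred_neq_suc[of n i] by (auto simp: face_succ_def)
  show "?a \<in> u_face n" using n by (auto simp: u_face_def cyc_suc_def intro!: image_eqI[of _ _ n])
  show "face_succ (antiprism_rot n) x \<in> u_face n" if "x \<in> u_face n" for x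
  proof -
    from that obtain i where i: "i \<in> {1..n}" "x = (Pu (cyc_suc n i), Pu i)"
      by (auto simp: u_face_def)
    then show ?thesis
      using step[of i] n cyc_pred_in[of n i] cyc_suc_pred[of n i]
      unfolding u_face_def by (intro image_eqI[of _ _ "cyc_pred n i"]) auto
  qed
  have "(Pu (cyc_suc n (n - k)), Pu (n - k)) \<in> orbit (face_succ (antiprism_rot n)) ?a" if "0 < k" "k < n" for k
    using that
  proof (induction k)
    case (Suc k)
    show ?case
    proof (cases "k = 0")
      case True
      then show ?thesis
        using step[of n] n orbit.base[of "face_succ (antiprism_rot n)" ?a] by (auto simp: cyc_suc_def cyc_pred_def)
    next
      case False
      then have "(Pu (cyc_suc n (n - k)), Pu (n - k)) \<in> orbit (face_succ (antiprism_rot n)) ?a" using Suc by simp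
      from orbit.step[OF this] show ?thesis
        using step[of "n - k"] n False Suc.prems by (auto simp: cyc_suc_def cyc_pred_def Suc_diff_Suc split: if_splits)
    qed
  qed simp
  from this[of "n - i" for i]
  have 1: "(Pu (cyc_suc n i), Pu i) \<in> orbit (face_succ (antiprism_rot n)) ?a" if "i \<in> {1..<n}" for i
    using that by simp
  have "face_succ (antiprism_rot n) (Pu 2, Pu 1) = ?a" using step[of 1] n by (simp add: cyc_suc_def cyc_pred_def numeral_2_eq_2)
  moreover have "(Pu 2, Pu 1) \<in> orbit (face_succ (antiprism_rot n)) ?a" using 1[of 1] n by (simp add: cyc_suc_def numeral_2_eq_2)
  ultimately have "?a \<in> orbit (face_succ (antiprism_rot n)) ?a" using orbit.step by metis
  then have "(Pu (cyc_suc n i), Pu i) \<in> orbit (face_succ (antiprism_rot n)) ?a" if "i \<in> {1..n}" for i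
    using that 1[of i] by (cases "i = n") (auto simp: cyc_suc_def)
  then show "u_face n \<subseteq> orbit (face_succ (antiprism_rot n)) ?a" by (auto simp: u_face_def)
qed

lemma cyclic_vvu_face: "i \<in> {1..n} \<Longrightarrow> cyclic_on (face_succ (antiprism_rot n)) (vvu_face n i)"
  unfolding vvu_face_def using n cyc_suc_in[of n i]
  by (intro cyclic_on_3) (auto simp: face_succ_def cyc_simps)

lemma cyclic_uuv_face: "i \<in> {1..n} \<Longrightarrow> cyclic_on (face_succ (antiprism_rot n)) (uuv_face n i)"
  unfolding uuv_face_def using n cyc_suc_in[of n i]
  by (intro cyclic_on_3) (auto simp: face_succ_def cyc_simps)

lemma parcs_antiprism_faces:
  "parcs (antiprism n) = v_face n \<union> u_face n \<union> (\<Union>i\<in>{1..n}. vvu_face n i \<union> uuv_face n i)"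
    (is "?L = ?R")
proof
  show "?R \<subseteq> ?L"
  proof
    fix x assume "x \<in> ?R"
    then obtain i where i: "i \<in> {1..n}" and
      "x \<in> {(Pv i, Pv (cyc_suc n i)), (Pu (cyc_suc n i), Pu i)} \<union> vvu_face n i \<union> uuv_face n i"
      unfolding v_face_def u_face_def by blast
    then consider "x \<in> {(Pv i, Pv (cyc_suc n i)), (Pv (cyc_suc n i), Pv i),
     (Pu i, Pu (cyc_suc n i)), (Pu (cyc_suc n i), Pu i), (Pu i, Pv i), (Pv i, Pu i),
     (Pu (cyc_suc n i), Pv i), (Pv i, Pu (cyc_suc n i))}"
      | "x = (Pu (cyc_suc n i), Pv (cyc_suc n i))"
      unfolding vvu_face_def uuv_face_def by blast
    then show "x \<in> ?L"
    proof cases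
      case 1
      obtain y z where x: "x = (y, z)" by (cases x)
      show ?thesis unfolding x antiprism_arc_iff[OF n] by (rule bexI[OF _ i]) (use 1 x in simp)
    next
      case 2
      show ?thesis unfolding 2 antiprism_arc_iff[OF n]
        by (rule bexI[OF _ cyc_suc_in[OF n i]]) simp
    qed
  qed
next
  have "(x, y) \<in> ?R" if xy: "(x, y) \<in> ?L" for x y
  proof -
    obtain i where i: "i \<in> {1..n}" and e: "(x, y) \<in>
      {(Pv i, Pv (cyc_suc n i)), (Pv (cyc_suc n i), Pv i),
     (Pu i, Pu (cyc_suc n i)), (Pu (cyc_suc n i), Pu i), (Pu i, Pv i), (Pv i, Pu i),
     (Pu (cyc_suc n i), Pv i), (Pv i, Pu (cyc_suc n i))}"
      using xy unfolding antiprism_arc_iff[OF n] by (rule bexE)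
    have p: "cyc_pred n i \<in> {1..n}" "cyc_suc n (cyc_pred n i) = i"
      using cyc_pred_in[OF n i] cyc_suc_pred[OF n i] by auto
    have "(Pu i, Pv i) \<in> vvu_face n (cyc_pred n i)" by (simp add: vvu_face_def p)
    then have "(Pu i, Pv i) \<in> ?R" using p(1) by blast
    moreover have "(Pv i, Pu (cyc_suc n i)) \<in> ?R" "(Pv (cyc_suc n i), Pv i) \<in> ?R"
      using i by (auto simp: vvu_face_def)
    moreover have "(Pv i, Pu i) \<in> ?R" "(Pu (cyc_suc n i), Pv i) \<in> ?R"
       "(Pu i, Pu (cyc_suc n i)) \<in> ?R"
      using i by (auto simp: uuv_face_def)
    moreover have "(Pv i, Pv (cyc_suc n i)) \<in> ?R" "(Pu (cyc_suc n i), Pu i) \<in> ?R"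
      using i by (auto simp: v_face_def u_face_def)
    ultimately show ?thesis using e by (elim insertE emptyE) simp_all
  qed
  then show "?L \<subseteq> ?R" by auto
qed

lemma faces_antiprism:
  "faces (antiprism n) (antiprism_rot n) =
     {v_face n, u_face n} \<union> vvu_face n ` {1..n} \<union> uuv_face n ` {1..n}"
proof -
  have *: "orbit (face_succ (antiprism_rot n)) ` S = {S}" if "cyclic_on (face_succ (antiprism_rot n)) S" for S
  proof -
    have "S \<noteq> {}" using that by (auto simp: cyclic_on_def)
    then show ?thesis using orbit_cyclic_eq3[OF that] by auto
  qed
  show ?thesis
    unfolding faces_def parcs_antiprism_faces image_Un image_UN
    using *[OF cyclic_v_face] *[OF cyclic_u_face] *[OF cyclic_vvu_face] *[OF cyclic_uuv_face]
    by auto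
qed

lemma card_faces_antiprism: "card (faces (antiprism n) (antiprism_rot n)) = 2 * n + 2"
proof -
  have vvu: "(Pv i, Pu (cyc_suc n i)) \<in> vvu_face n i" "(Pv (cyc_suc n i), Pv i) \<in> vvu_face n i"
    and uuv: "(Pv i, Pu i) \<in> uuv_face n i" for i
    by (simp_all add: vvu_face_def uuv_face_def)
  have inj1: "inj_on (vvu_face n) {1..n}"
  proof (rule inj_onI)
    fix i j assume "vvu_face n i = vvu_face n j"
    then have "(Pv i, Pu (cyc_suc n i)) \<in> vvu_face n j" using vvu(1)[of i] by simp
    then show "i = j" by (simp add: vvu_face_def)
  qed
  have inj2: "inj_on (uuv_face n) {1..n}"
  proof (rule inj_onI)
    fix i j assume "uuv_face n i = uuv_face n j"
    then have "(Pv i, Pu i) \<in> uuv_face n j" using uuv[of i] by simp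
    then show "i = j" by (simp add: uuv_face_def)
  qed
  have v: "(Pv 1, Pv (cyc_suc n 1)) \<in> v_face n"
    using n by (auto simp: v_face_def)
  have not: "(Pv i, Pu j) \<notin> v_face n" "(Pv i, Pu j) \<notin> u_face n" "(Pv i, Pv j) \<notin> u_face n"
    "(Pv i, Pv j) \<notin> uuv_face n k" for i j k
    by (auto simp: v_face_def u_face_def uuv_face_def)
  have "v_face n \<noteq> u_face n" "v_face n \<noteq> vvu_face n i" "u_face n \<noteq> vvu_face n i"
    "v_face n \<noteq> uuv_face n i" "u_face n \<noteq> uuv_face n i" "vvu_face n i \<noteq> uuv_face n j" for i j
    using v vvu[of i] uuv[of i] not by metis+
  then have disj: "{v_face n, u_face n} \<inter> (vvu_face n ` {1..n} \<union> uuv_face n ` {1..n}) = {}"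
    "vvu_face n ` {1..n} \<inter> uuv_face n ` {1..n} = {}" "card {v_face n, u_face n} = 2"
    by auto
  have "card (vvu_face n ` {1..n} \<union> uuv_face n ` {1..n}) = 2 * n"
    using disj(2) card_image[OF inj1] card_image[OF inj2] by (simp add: card_Un_disjoint)
  then show ?thesis
    unfolding faces_antiprism Un_assoc using card_Un_disjoint[OF _ _ disj(1)] disj(3) by simp
qed

lemma connected_antiprism: "Digraph_Component.connected (with_proj (antiprism n))"
proof -
  interpret pair_graph "antiprism n" by (rule pair_graph_antiprism[OF n])
  let ?G = "with_proj (antiprism n)"
  have v: "Pv 1 \<rightarrow>\<^sup>*\<^bsub>?G\<^esub> Pv (Suc k)" if "k < n" for k
    using that
  proof (induction k)
    case 0
    then show ?case by (auto simp: pverts_antiprism)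
  next
    case (Suc k)
    have "(Pv (Suc k), Pv (Suc (Suc k))) \<in> parcs (antiprism n)"
      unfolding antiprism_arc_iff[OF n]
      using Suc.prems by (intro bexI[of _ "Suc k"]) (auto simp: cyc_suc_def)
    with Suc show ?case by (auto intro: reachable_adj_trans)
  qed
  have v': "Pv 1 \<rightarrow>\<^sup>*\<^bsub>?G\<^esub> Pv i" if "i \<in> {1..n}" for i
    using that v[of "i - 1"] by auto
  have u': "Pv 1 \<rightarrow>\<^sup>*\<^bsub>?G\<^esub> Pu i" if "i \<in> {1..n}" for i
  proof -
    have "(Pv i, Pu i) \<in> parcs (antiprism n)"
      using antiprism_nbrs_v[OF n that] by auto
    then show ?thesis using v'[OF that] by (auto intro: reachable_adj_trans)
  qed
  have *: "Pv 1 \<rightarrow>\<^sup>*\<^bsub>?G\<^esub> x" if "x \<in> pverts (antiprism n)" for x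
    using that v' u' by (auto simp: pverts_antiprism)
  have "x \<rightarrow>\<^sup>*\<^bsub>?G\<^esub> y" if "x \<in> pverts (antiprism n)" "y \<in> pverts (antiprism n)" for x y
    using symmetric_reachable'[OF *[OF that(1)]] *[OF that(2)] by (rule reachable_trans)
  then have "x \<rightarrow>\<^sup>*\<^bsub>mk_symmetric ?G\<^esub> y"
    if "x \<in> pverts (antiprism n)" "y \<in> pverts (antiprism n)" for x y
    using that by (intro reachable_mk_symmetricI) auto
  then show ?thesis
    using n unfolding connected_def strongly_connected_def
    by (auto simp: pverts_antiprism)
qed

lemma plane_graph_antiprism: "plane_graph (antiprism n) (antiprism_rot n)"
proof -
  interpret pair_graph "antiprism n" by (rule pair_graph_antiprism[OF n])
  show ?thesis
  proof
    fix v assume "v \<in> pverts (antiprism n)"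
    then consider (v) i where "i \<in> {1..n}" "v = Pv i" | (u) i where "i \<in> {1..n}" "v = Pu i"
      by (auto simp: pverts_antiprism)
    then show "cyclic_on (antiprism_rot n v) {w. (v, w) \<in> parcs (antiprism n)}"
    proof cases
      case v
      show ?thesis unfolding v antiprism_nbrs_v[OF n v(1)]
        using n v(1) by (intro cyclic_on_4) (auto simp: cyc_simps)
    next
      case u
      show ?thesis unfolding u antiprism_nbrs_u[OF n u(1)]
        using n u(1) by (intro cyclic_on_4) (auto simp: cyc_simps)
    qed
  next
    show "Digraph_Component.connected (with_proj (antiprism n))" by (rule connected_antiprism)
  next
    show "int (card (pverts (antiprism n))) - int (card (parcs (antiprism n)) div 2) +
        int (card (faces (antiprism n) (antiprism_rot n))) = 2"
      by (simp add: card_verts_antiprism card_arcs_antiprism[OF n] card_faces_antiprism)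
  qed
qed

end

end

theory Submission
  imports Defs "HOL-Library.Sublist"
begin

text \<open>
  Every cycle has a list colouring without cyclic repetitions from lists of size 5. Granting this,
  colour the cycle of the \<open>u\<^sub>i\<close> first; each \<open>v\<^sub>i\<close> then loses the colours of its two neighbours
  \<open>u\<^sub>i\<close>, \<open>u\<^sub>i\<^sub>+\<^sub>1\<close> and keeps a list of size 5, so the other cycle can be coloured as well. Facial
  paths either run along one of the two cycles or lie in a triangle, where being proper suffices.

  For the claim about cycles we count in the style of Rosenfeld. Let \<open>N(P)\<close> be the number of
  non-repetitive colourings of a path \<open>P\<close> from lists of size 5. Appending a vertex to \<open>P\<close> gives
  \<open>5 N(P)\<close> candidates; those ending in a square of period \<open>j\<close> are determined by a path with
  \<open>j - 1\<close> vertices fewer than \<open>P\<close>, so inductively there are at most \<open>N(P) / 3\<^sup>j\<^sup>-\<^sup>1\<close> of them, and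
  \<open>5 - 3/2 \<ge> 3\<close> keeps the growth rate 3. When the last vertex closes the cycle, a square of
  period \<open>j\<close> through it can start at at most \<open>2j\<close> positions, and
  \<open>\<Sum> 2j / 3\<^sup>j\<^sup>-\<^sup>1 = 9/2 < 5\<close>, so some candidate survives.
\<close>

section \<open>Squares, and words without squares drawn from lists\<close>

lemma repetition_iff_square: "repetition r \<longleftrightarrow> (\<exists>u. u \<noteq> [] \<and> r = u @ u)"
proof
  assume "repetition r"
  then obtain n where n: "n \<ge> 1" "length r = 2 * n" "\<forall>i<n. r ! i = r ! (n + i)"
    unfolding repetition_def by blast
  have "take n r = drop n r"
    by (rule nth_equalityI) (use n in auto)
  then have "r = take n r @ take n r" by (metis append_take_drop_id)
  moreover have "take n r \<noteq> []" using n by auto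
  ultimately show "\<exists>u. u \<noteq> [] \<and> r = u @ u" by blast
next
  assume "\<exists>u. u \<noteq> [] \<and> r = u @ u"
  then obtain u where u: "u \<noteq> []" "r = u @ u" by blast
  then have "length u \<ge> 1" by (simp add: Suc_leI)
  then show "repetition r"
    unfolding repetition_def by (intro exI[of _ "length u"]) (auto simp: u nth_append)
qed

text \<open>Reversing \<open>u @ u\<close> gives the square of \<open>rev u\<close>. This lets
  counting work at either end of a path, and facial paths run against their boundary walk.\<close>

lemma repetition_rev: "repetition (rev r) \<longleftrightarrow> repetition r"
proof -
  have "repetition (rev r)" if "repetition r" for r :: "'a list"
    using that unfolding repetition_iff_square by (metis rev_append rev_is_Nil_conv)
  from this[of r] this[of "rev r"] show ?thesis by auto
qed

text \<open>The colourings counted by N(P) above: a word is a colouring of a path, read vertex by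
  vertex, and a contiguous block is a subpath.\<close>

definition nonrep_words :: "'c set list \<Rightarrow> 'c list set" where
  "nonrep_words Ls = {w. list_all2 (\<in>) w Ls \<and> (\<forall>r. sublist r w \<longrightarrow> \<not> repetition r)}"

lemma length_nonrep_words: "w \<in> nonrep_words Ls \<Longrightarrow> length w = length Ls"
  by (auto simp: nonrep_words_def list_all2_lengthD)

lemma finite_nonrep_words:
  assumes "\<forall>A\<in>set Ls. card A = 5"
  shows "finite (nonrep_words Ls)"
proof -
  \<comment> \<open>Infinite sets have \<open>card\<close> 0, so size 5 already forces
    finiteness.\<close>
  have "finite A" if "A \<in> set Ls" for A
    using assms that card.infinite[of A] by fastforce
  then have "finite (\<Union>(set Ls))" by blast
  moreover have "nonrep_words Ls \<subseteq> {w. set w \<subseteq> \<Union>(set Ls) \<and> length w = length Ls}"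
    unfolding nonrep_words_def list_all2_conv_all_nth
    by (safe, metis UnionI in_set_conv_nth)
  ultimately show ?thesis
    using finite_subset finite_lists_length_eq by blast
qed

lemma card_nonrep_words_rev: "card (nonrep_words (rev Ls)) = card (nonrep_words Ls)"
proof -
  have sub: "rev ` nonrep_words Ks \<subseteq> nonrep_words (rev Ks)" for Ks :: "'a set list"
  proof -
    have "\<not> repetition r" if "\<forall>r. sublist r w \<longrightarrow> \<not> repetition r" "sublist r (rev w)" for r w :: "'a list"
      using that by (metis repetition_rev rev_rev_ident sublist_rev)
    then show ?thesis
      by (auto simp: nonrep_words_def)
  qed
  have "nonrep_words (rev Ls) = rev ` nonrep_words Ls"
  proof
    have "rev ` rev ` nonrep_words (rev Ls) \<subseteq> rev ` nonrep_words Ls"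
      using sub[of "rev Ls"] by (intro image_mono) simp
    then show "nonrep_words (rev Ls) \<subseteq> rev ` nonrep_words Ls" by (simp add: image_image)
  qed (rule sub)
  then show ?thesis by (simp add: card_image)
qed

text \<open>Restricting a word to a window keeps it square-free. This is what sends bad words to
  words on shorter paths.\<close>

lemma nonrep_words_sublist:
  assumes "w \<in> nonrep_words (xs @ ys @ zs)"
  shows "take (length ys) (drop (length xs) w) \<in> nonrep_words ys"
proof -
  have len: "length w = length xs + length ys + length zs"
    using length_nonrep_words[OF assms] by simp
  have "sublist (take (length ys) (drop (length xs) w)) w"
    by (meson sublist_drop sublist_order.order_trans sublist_take)
  then have "\<forall>r. sublist r (take (length ys) (drop (length xs) w)) \<longrightarrow> \<not> repetition r"
    using assms sublist_order.order_trans unfolding nonrep_words_def by blast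
  moreover have "list_all2 (\<in>) (take (length ys) (drop (length xs) w)) ys"
    unfolding list_all2_conv_all_nth
  proof (intro conjI allI impI)
    show *: "length (take (length ys) (drop (length xs) w)) = length ys" using len by simp
    fix i assume "i < length (take (length ys) (drop (length xs) w))"
    then have i: "i < length ys" using * by simp
    have "w ! k \<in> (xs @ ys @ zs) ! k" if "k < length w" for k
      using assms that unfolding nonrep_words_def list_all2_conv_all_nth by blast
    from this[of "length xs + i"] show "take (length ys) (drop (length xs) w) ! i \<in> ys ! i"
      using i len by (simp add: nth_append)
  qed
  ultimately show ?thesis by (simp add: nonrep_words_def)
qed

section \<open>Growth of the number of square-free words on a path\<close>

lemma card_snoc_words: "card ((\<lambda>(w, c). w @ [c]) ` (A \<times> B)) = card A * card B"
  by (subst card_image) (auto simp: inj_on_def card_cartesian_product)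

lemma geometric_third: "(\<Sum>j = 1..m. (1 / 3 :: real) ^ (j - 1)) \<le> 3 / 2"
proof -
  have "(\<Sum>j = 1..m. (1 / 3 :: real) ^ (j - 1)) = 3 / 2 - 3 / 2 * (1 / 3) ^ m"
    by (induction m) (simp_all add: sum.atLeast1_atMost_eq)
  then show ?thesis by simp
qed

text \<open>The closed form found by induction subtracts a nonnegative tail from the full series.
  The weight j will count where a square of period j can lie relative to the closing vertex.\<close>

lemma arithmetic_geometric_third: "(\<Sum>j = 1..m. real j * (1 / 3) ^ (j - 1)) \<le> 9 / 4"
proof -
  have "(\<Sum>j = 1..m. real j * (1 / 3) ^ (j - 1)) = 9 / 4 - (1 / 3) ^ m * (9 / 4 + 3 / 2 * real m)"
  proof (induction m)
    case (Suc m)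
    define x :: real where "x = (1 / 3) ^ m"
    show ?case
      using Suc by (simp del: power_one_over add: x_def[symmetric]) (simp add: algebra_simps)
  qed simp
  then show ?thesis by simp
qed

text \<open>The induction is on length rather than structural: bounding the squares of period j
  needs the factor 3 for j - 1 earlier extensions as well.\<close>

lemma card_nonrep_words_snoc:
  assumes "\<forall>A\<in>set (Ls @ [S]). card A = 5"
  shows "3 * card (nonrep_words Ls) \<le> card (nonrep_words (Ls @ [S]))"
  using assms
proof (induction Ls arbitrary: S rule: length_induct)
  case (1 Ls)
  define n N where "n = length Ls" and "N = real (card (nonrep_words Ls))"
  \<comment> \<open>The induction hypothesis, iterated over \<open>zs\<close>. It applies because
    each prefix \<open>ys @ zs\<close> it is used on is followed by some \<open>z\<close> in
    \<open>Ls\<close>, hence is shorter than \<open>Ls\<close>.\<close>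
  have prefix: "3 ^ length zs * card (nonrep_words ys) \<le> card (nonrep_words (ys @ zs))"
    if "\<exists>xs. Ls = ys @ zs @ xs" for ys zs
    using that
  proof (induction zs rule: rev_induct)
    case (snoc z zs)
    then obtain xs where xs: "Ls = ys @ zs @ [z] @ xs" by auto
    have "3 ^ length zs * card (nonrep_words ys) \<le> card (nonrep_words (ys @ zs))"
      using xs by (intro snoc.IH) auto
    moreover have "3 * card (nonrep_words (ys @ zs)) \<le> card (nonrep_words ((ys @ zs) @ [z]))"
      using "1.prems" xs by (intro "1.IH"[rule_format]) auto
    ultimately show ?case by simp
  qed simp
  define E where "E = (\<lambda>(w, c). w @ [c]) ` (nonrep_words Ls \<times> S)"
  \<comment> \<open>Words in \<open>E\<close> have length n + 1, so these are the candidates whose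
    last 2j letters form a square.\<close>
  define B where "B j = {w \<in> E. \<forall>i<j. w ! (n + 1 - 2 * j + i) = w ! (n + 1 - j + i)}" for j
  have S: "card S = 5" "finite S"
    using "1.prems" card.infinite[of S] by fastforce+
  have fin: "finite (nonrep_words Ls)" "finite (nonrep_words (Ls @ [S]))"
    using "1.prems" by (auto intro!: finite_nonrep_words)
  have cardE: "card E = 5 * card (nonrep_words Ls)"
    unfolding E_def card_snoc_words using S by simp
  have finE: "finite E" unfolding E_def using fin S by auto
  have lenE: "length w = n + 1" if "w \<in> E" for w
    using that length_nonrep_words by (auto simp: E_def n_def)
  have cover: "E \<subseteq> nonrep_words (Ls @ [S]) \<union> (\<Union>j\<in>{1..(n+1) div 2}. B j)"
  proof
    fix w assume w: "w \<in> E"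
    then obtain u c where uc: "w = u @ [c]" "u \<in> nonrep_words Ls" "c \<in> S" by (auto simp: E_def)
    have l2: "list_all2 (\<in>) w (Ls @ [S])"
      using uc by (auto simp: nonrep_words_def intro: list_all2_appendI)
    show "w \<in> nonrep_words (Ls @ [S]) \<union> (\<Union>j\<in>{1..(n+1) div 2}. B j)"
    proof (cases "w \<in> nonrep_words (Ls @ [S])")
      case False
      then obtain r where r: "sublist r w" "repetition r"
        using l2 by (auto simp: nonrep_words_def)
      then obtain p q where pq: "u @ [c] = p @ r @ q" by (auto simp: sublist_def uc)
      \<comment> \<open>A square ending before the new letter would already lie in
        \<open>u\<close>.\<close>
      have "q = []"
      proof (rule ccontr)
        assume "q \<noteq> []"
        then obtain q' where "u = p @ r @ q'"
          using pq by (metis append.assoc append_butlast_last_id butlast_snoc)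
        then have "sublist r u" by (auto simp: sublist_def)
        then show False using uc(2) r(2) by (auto simp: nonrep_words_def)
      qed
      obtain v where v: "v \<noteq> []" "r = v @ v" using r(2) by (auto simp: repetition_iff_square)
      have wp: "w = p @ v @ v" using pq uc \<open>q = []\<close> v by simp
      then have ln: "length p + 2 * length v = n + 1" using lenE[OF w] by simp
      then have e: "n + 1 - 2 * length v = length p" "n + 1 - length v = length p + length v" by auto
      have "w \<in> B (length v)" unfolding B_def e using w by (simp add: wp nth_append)
      moreover have "length v \<in> {1..(n+1) div 2}"
        using ln v(1) by (auto simp: Suc_le_eq)
      ultimately show ?thesis by blast
    qed simp
  qed
  have bad: "real (card (B j)) \<le> N * (1 / 3) ^ (j - 1)" if j: "j \<in> {1..(n+1) div 2}" for j
  proof -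
    have ls: "Ls = take (n + 1 - j) Ls @ drop (n + 1 - j) Ls" by simp
    have "card (B j) \<le> card (nonrep_words (take (n + 1 - j) Ls))"
    \<comment> \<open>Cutting off the last j letters is injective on \<open>B j\<close>, since they
      copy the j letters before them.\<close>
    proof (rule card_inj_on_le)
      show "finite (nonrep_words (take (n + 1 - j) Ls))"
        using 1 by (intro finite_nonrep_words) (auto dest: in_set_takeD)
      show "take (n + 1 - j) ` B j \<subseteq> nonrep_words (take (n + 1 - j) Ls)"
      proof (rule image_subsetI)
        fix w assume "w \<in> B j"
        then obtain u c where uc: "w = u @ [c]" "u \<in> nonrep_words Ls" by (auto simp: B_def E_def)
        have "take (n + 1 - j) w = take (n + 1 - j) u"
          using uc length_nonrep_words[OF uc(2)] j by (simp add: n_def)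
        moreover have "length (take (n + 1 - j) Ls) = n + 1 - j" using j by (auto simp: n_def)
        then have "take (n + 1 - j) u \<in> nonrep_words (take (n + 1 - j) Ls)"
          using nonrep_words_sublist[of u "[]" "take (n + 1 - j) Ls" "drop (n + 1 - j) Ls"] uc
          by (simp del: length_take)
        ultimately show "take (n + 1 - j) w \<in> nonrep_words (take (n + 1 - j) Ls)" by simp
      qed
      show "inj_on (take (n + 1 - j)) (B j)"
      proof (rule inj_onI)
        fix x y assume x: "x \<in> B j" and y: "y \<in> B j" and eq: "take (n + 1 - j) x = take (n + 1 - j) y"
        have len: "length x = n + 1" "length y = n + 1" using x y lenE by (auto simp: B_def)
        have low: "x ! k = y ! k" if "k < n + 1 - j" for k
          using eq that by (metis nth_take)
        show "x = y"
        proof (rule nth_equalityI)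
          fix k assume "k < length x"
          then have k: "k < n + 1" using len by simp
          show "x ! k = y ! k"
          proof (cases "k < n + 1 - j")
            case False
            define i where "i = k - (n + 1 - j)"
            have i: "i < j" "k = n + 1 - j + i" "n + 1 - 2 * j + i < n + 1 - j"
              using False k j by (auto simp: i_def)
            have "x ! k = x ! (n + 1 - 2 * j + i)" "y ! k = y ! (n + 1 - 2 * j + i)"
              using x y i unfolding B_def by auto
            then show ?thesis using low[OF i(3)] by simp
          qed (rule low)
        qed (simp add: len)
      qed
    qed
    \<comment> \<open>Of the j letters cut off, one belongs to \<open>S\<close>, so the remaining
      prefix is j - 1 lists shorter than \<open>Ls\<close>.\<close>
    moreover have "3 ^ (j - 1) * card (nonrep_words (take (n + 1 - j) Ls)) \<le> card (nonrep_words Ls)"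
    proof -
      have "n - (n + 1 - j) = j - 1" using j by auto
      then show ?thesis
        using prefix[OF exI[of _ "[]"], of "take (n + 1 - j) Ls" "drop (n + 1 - j) Ls"]
        by (simp add: n_def)
    qed
    ultimately have "3 ^ (j - 1) * card (B j) \<le> card (nonrep_words Ls)"
      by (meson le_trans mult_le_mono2)
    then have "real (3 ^ (j - 1) * card (B j)) \<le> N" unfolding N_def of_nat_le_iff .
    then show ?thesis by (simp add: field_simps)
  qed
  have "card E \<le> card (nonrep_words (Ls @ [S]) \<union> (\<Union>j\<in>{1..(n+1) div 2}. B j))"
    using cover fin finE by (intro card_mono) (auto simp: B_def)
  also have "\<dots> \<le> card (nonrep_words (Ls @ [S])) + card (\<Union>j\<in>{1..(n+1) div 2}. B j)"
    by (rule card_Un_le)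
  also have "card (\<Union>j\<in>{1..(n+1) div 2}. B j) \<le> (\<Sum>j = 1..(n+1) div 2. card (B j))"
    by (rule card_UN_le) simp
  finally have "real (card E) \<le> card (nonrep_words (Ls @ [S])) + (\<Sum>j = 1..(n+1) div 2. real (card (B j)))"
    by (simp flip: of_nat_sum of_nat_add)
  also have "(\<Sum>j = 1..(n+1) div 2. real (card (B j))) \<le> (\<Sum>j = 1..(n+1) div 2. N * (1 / 3) ^ (j - 1))"
    using bad by (rule sum_mono)
  also have "\<dots> = N * (\<Sum>j = 1..(n+1) div 2. (1 / 3) ^ (j - 1))"
    by (simp add: sum_distrib_left)
  also have "\<dots> \<le> N * (3 / 2)"
    using geometric_third by (intro mult_left_mono) (auto simp: N_def)
  finally have "5 * N \<le> card (nonrep_words (Ls @ [S])) + N * (3 / 2)"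
    by (simp add: cardE N_def)
  moreover have "N \<ge> 0" by (simp add: N_def)
  ultimately have "3 * N \<le> card (nonrep_words (Ls @ [S]))" by linarith
  then show ?case unfolding N_def by linarith
qed

lemma card_nonrep_words_append:
  assumes "\<forall>A\<in>set (Ks @ Ls). card A = 5"
  shows "3 ^ length Ls * card (nonrep_words Ks) \<le> card (nonrep_words (Ks @ Ls))"
  using assms
proof (induction Ls rule: rev_induct)
  case (snoc S Ls)
  then have "3 ^ length Ls * card (nonrep_words Ks) \<le> card (nonrep_words (Ks @ Ls))"
    by simp
  moreover have "3 * card (nonrep_words (Ks @ Ls)) \<le> card (nonrep_words ((Ks @ Ls) @ [S]))"
    using snoc.prems by (intro card_nonrep_words_snoc) auto
  ultimately show ?case by simp
qed simp

text \<open>Extension on the left is extension on the right of the reversed lists.\<close>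

lemma card_nonrep_words_infix:
  assumes "\<forall>A\<in>set (Js @ Ks @ Ls). card A = 5"
  shows "3 ^ (length Js + length Ls) * card (nonrep_words Ks) \<le> card (nonrep_words (Js @ Ks @ Ls))"
proof -
  have "\<forall>A\<in>set (rev Ks @ rev Js). card A = 5" using assms by auto
  then have "3 ^ length Js * card (nonrep_words Ks) \<le> card (nonrep_words (Js @ Ks))"
    using card_nonrep_words_append[of "rev Ks" "rev Js"] card_nonrep_words_rev[of Ks] card_nonrep_words_rev[of "Js @ Ks"] by simp
  then have "3 ^ length Ls * (3 ^ length Js * card (nonrep_words Ks)) \<le> 3 ^ length Ls * card (nonrep_words (Js @ Ks))"
    by (rule mult_le_mono2)
  also have "\<dots> \<le> card (nonrep_words ((Js @ Ks) @ Ls))"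
    using assms by (intro card_nonrep_words_append) auto
  finally show ?thesis by (simp add: power_add mult_ac)
qed

lemma nonrep_words_pos:
  assumes "\<forall>A\<in>set Ls. card A = 5"
  shows "card (nonrep_words Ls) > 0"
proof -
  have "nonrep_words [] = {[] :: 'a list}"
    by (auto simp: nonrep_words_def repetition_def)
  then show ?thesis
    using card_nonrep_words_append[of "[]" Ls] assms
    by (simp add: Suc_le_eq less_le_trans[of 0 "3 ^ length Ls"])
qed

section \<open>Words without squares around a cycle\<close>

definition cyclically_nonrep :: "'c list \<Rightarrow> bool" where
  "cyclically_nonrep w \<longleftrightarrow> (\<forall>s j. 1 \<le> j \<longrightarrow> 2 * j \<le> length w \<longrightarrow>
     (\<exists>i<j. w ! ((s + i) mod length w) \<noteq> w ! ((s + j + i) mod length w)))"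

text \<open>The candidates are square-free on the path without the last vertex, so every cyclic
  square goes through that vertex. A union bound over the positions of such squares shows that they
  cannot spoil all candidates.\<close>

lemma cyclically_nonrep_word_exists:
  assumes card5: "\<forall>A\<in>set Ls. card A = 5"
  shows "\<exists>w. list_all2 (\<in>) w Ls \<and> cyclically_nonrep w"
proof (cases Ls rule: rev_cases)
  case Nil
  then show ?thesis by (simp add: cyclically_nonrep_def)
next
  case (snoc As S)
  define n N where "n = length Ls" and "N = real (card (nonrep_words As))"
  have n: "n = length As + 1" by (simp add: n_def snoc)
  have S: "card S = 5" "finite S"
    using card5 snoc card.infinite[of S] by fastforce+
  have fin: "finite (nonrep_words As)"
    using card5 snoc by (auto intro!: finite_nonrep_words)
  define E where "E = (\<lambda>(w, c). w @ [c]) ` (nonrep_words As \<times> S)"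
  have cardE: "card E = 5 * card (nonrep_words As)"
    unfolding E_def card_snoc_words using S by simp
  have finE: "finite E" unfolding E_def using fin S by auto
  have lenE: "length w = n" if "w \<in> E" for w
    using that length_nonrep_words by (auto simp: E_def n)
  have listE: "list_all2 (\<in>) w Ls" if "w \<in> E" for w
    using that by (auto simp: E_def snoc nonrep_words_def intro: list_all2_appendI)
  \<comment> \<open>\<open>j\<close> is the period, and the half of the square that contains the last vertex starts \<open>d\<close>
     vertices before it; \<open>e\<close> is the cyclic offset of the other half, namely \<open>j\<close> if that half comes
     second and \<open>n - j\<close> if it comes first.\<close>
  define B where "B j d e =
    {w \<in> E. \<forall>i<j. w ! ((n - 1 - d + i) mod n) = w ! ((n - 1 - d + i + e) mod n)}" for j d e
  define K where "K = Sigma {1..n div 2} (\<lambda>j. {..<j} \<times> {j, n - j})"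
  \<comment> \<open>Both offsets are treated at once: j \<le> e \<le> n - j says that the two halves
    are disjoint on the cycle.\<close>
  have bad: "real (card (B j d e)) \<le> N * (1 / 3) ^ (j - 1)"
    if j: "1 \<le> j" "2 * j \<le> n" and d: "d < j" and e: "j \<le> e" "e \<le> n - j" for j d e
  proof -
    \<comment> \<open>Read cyclically, the half containing the last vertex consists of
      \<open>zs\<close>, that vertex and \<open>xs\<close>. Erasing it leaves the contiguous window
      \<open>ys\<close>, which is j - 1 lists shorter than \<open>As\<close>.\<close>
    define xs ys zs where "xs = take (j - 1 - d) As" and "ys = take (n - j) (drop (j - 1 - d) As)"
      and "zs = drop (n - j) (drop (j - 1 - d) As)"
    have As: "As = xs @ ys @ zs" unfolding xs_def ys_def zs_def append_take_drop_id ..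
    have len: "length xs = j - 1 - d" "length ys = n - j" "length zs = d"
      using j d by (auto simp: xs_def ys_def zs_def n)
    let ?m = "\<lambda>w. take (length ys) (drop (length xs) w)"
    have "card (B j d e) \<le> card (nonrep_words ys)"
    proof (rule card_inj_on_le)
      show "finite (nonrep_words ys)"
        using card5 by (intro finite_nonrep_words) (auto simp: snoc As)
      show "?m ` B j d e \<subseteq> nonrep_words ys"
      proof (rule image_subsetI)
        fix w assume "w \<in> B j d e"
        then obtain u c where uc: "w = u @ [c]" "u \<in> nonrep_words As" by (auto simp: B_def E_def)
        have "length u = length xs + length ys + length zs"
          using length_nonrep_words[OF uc(2)] As by simp
        then have "?m w = ?m u" using uc(1) by simp
        then show "?m w \<in> nonrep_words ys"
          using nonrep_words_sublist[of u xs ys zs] uc(2) by (simp only: As)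
      qed
      show "inj_on ?m (B j d e)"
      proof (rule inj_onI)
        fix x y assume x: "x \<in> B j d e" and y: "y \<in> B j d e" and eq: "?m x = ?m y"
        have lxy: "length x = n" "length y = n" using x y lenE by (auto simp: B_def)
        have mid: "x ! k = y ! k" if "j - 1 - d \<le> k" "k < n - 1 - d" for k
        proof -
          have k: "k - (j - 1 - d) < n - j" using that j d by auto
          have "?m x ! (k - (j - 1 - d)) = ?m y ! (k - (j - 1 - d))" using eq by simp
          then show ?thesis using k that lxy unfolding len by simp
        qed
        \<comment> \<open>Erased letters are recovered from the other half. Since d < j \<le> e
          \<le> n - j, its indices exceed n - 1 and, after subtracting n, land in the window covered
          by \<open>mid\<close>.\<close>
        have out: "x ! ((n - 1 - d + i) mod n) = y ! ((n - 1 - d + i) mod n)" if i: "i < j" for i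
        proof -
          define k where "k = (n - 1 - d + i + e) - n"
          have "n - 1 - d + i + e = k + n" "k < n" using j d e i by (auto simp: k_def)
          then have k': "(n - 1 - d + i + e) mod n = k" by simp
          have "x ! k = y ! k" using j d e i by (intro mid) (auto simp: k_def)
          then show ?thesis using x y i k' unfolding B_def by auto
        qed
        show "x = y"
        proof (rule nth_equalityI)
          fix k assume "k < length x"
          then have k: "k < n" using lxy by simp
          consider "k < j - 1 - d" | "j - 1 - d \<le> k" "k < n - 1 - d" | "n - 1 - d \<le> k" by linarith
          then show "x ! k = y ! k"
          proof cases
            case 1
            have "n - 1 - d + (k + 1 + d) = k + n" using j d k by auto
            then have "(n - 1 - d + (k + 1 + d)) mod n = k" using k by simp
            then show ?thesis using out[of "k + 1 + d"] 1 by simp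
          next
            case 3
            then have "(n - 1 - d + (k - (n - 1 - d))) mod n = k" using k by simp
            then show ?thesis using out[of "k - (n - 1 - d)"] 3 k d by simp
          qed (rule mid)
        qed (simp add: lxy)
      qed
    qed
    moreover have "3 ^ (j - 1) * card (nonrep_words ys) \<le> card (nonrep_words As)"
      using card_nonrep_words_infix[of xs ys zs] card5 d by (simp add: As snoc len)
    ultimately have "3 ^ (j - 1) * card (B j d e) \<le> card (nonrep_words As)"
      by (meson le_trans mult_le_mono2)
    then have "real (3 ^ (j - 1) * card (B j d e)) \<le> N" unfolding N_def of_nat_le_iff .
    then show ?thesis by (simp add: field_simps)
  qed
  have cover: "w \<in> (\<Union>(j, d, e)\<in>K. B j d e)" if w: "w \<in> E" and cyc: "\<not> cyclically_nonrep w" for w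
  proof -
    obtain s0 j where j: "1 \<le> j" "2 * j \<le> n"
      and rep0: "\<And>i. i < j \<Longrightarrow> w ! ((s0 + i) mod n) = w ! ((s0 + j + i) mod n)"
      using cyc unfolding cyclically_nonrep_def lenE[OF w] by auto
    define s where "s = s0 mod n"
    have s: "s < n" using n by (simp add: s_def)
    have rep: "w ! ((s + i) mod n) = w ! ((s + j + i) mod n)" if "i < j" for i
      using rep0[OF that] by (simp add: s_def mod_simps add.assoc)
    obtain u c where uc: "w = u @ [c]" "u \<in> nonrep_words As" using w by (auto simp: E_def)
    have lu: "length u = n - 1" using length_nonrep_words[OF uc(2)] n by simp
    \<comment> \<open>Otherwise the square would avoid position n - 1 and be a block of
      \<open>u\<close>.\<close>
    have "\<not> s + 2 * j \<le> n - 1"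
    proof
      assume le: "s + 2 * j \<le> n - 1"
      have "u ! (s + i) = u ! (s + (j + i))" if "i < j" for i
        using rep[OF that] le that s lu by (simp add: uc nth_append add.assoc)
      then have "repetition (take (2 * j) (drop s u))"
        unfolding repetition_def using j le lu by (intro exI[of _ j]) simp
      moreover have "sublist (take (2 * j) (drop s u)) u"
        by (meson sublist_drop sublist_order.order_trans sublist_take)
      ultimately show False using uc(2) by (auto simp: nonrep_words_def)
    qed
    \<comment> \<open>The last vertex lies in the first half or in the second half of the
      square.\<close>
    then consider "n - 1 < s + j" | "s + j \<le> n - 1" "n - 1 < s + 2 * j" by linarith
    then show ?thesis
    proof cases
      case 1
      define d where "d = n - 1 - s"
      have d: "d < j" "n - 1 - d = s" using 1 s by (auto simp: d_def)
      have "w \<in> B j d j" unfolding B_def d(2) using w rep by (simp add: add_ac)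
      moreover have "(j, d, j) \<in> K" using j d by (auto simp: K_def)
      ultimately show ?thesis by blast
    next
      case 2
      define d where "d = n - 1 - (s + j)"
      have d: "d < j" "n - 1 - d = s + j" using 2 by (auto simp: d_def)
      \<comment> \<open>On the cycle, going forward n - j is going back j, from the second half to
        the first.\<close>
      have "w ! ((s + j + i) mod n) = w ! ((s + j + i + (n - j)) mod n)" if "i < j" for i
      proof -
        have "s + j + i + (n - j) = s + i + n" using j by simp
        then have "(s + j + i + (n - j)) mod n = (s + i) mod n" by (simp only: mod_add_self2)
        then show ?thesis using rep[OF that] by (simp only:)
      qed
      then have "w \<in> B j d (n - j)" unfolding B_def d(2) using w by simp
      moreover have "(j, d, n - j) \<in> K" using j d by (auto simp: K_def)
      ultimately show ?thesis by blast
    qed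
  qed
  have finK: "finite K" unfolding K_def by auto
  have "card (\<Union>(j, d, e)\<in>K. B j d e) \<le> (\<Sum>(j, d, e)\<in>K. card (B j d e))"
    using card_UN_le[OF finK, of "\<lambda>(j, d, e). B j d e"] by (simp add: case_prod_unfold)
  then have "real (card (\<Union>(j, d, e)\<in>K. B j d e)) \<le> real (\<Sum>(j, d, e)\<in>K. card (B j d e))"
    by (simp only: of_nat_le_iff)
  also have "\<dots> = (\<Sum>(j, d, e)\<in>K. real (card (B j d e)))"
    by (simp add: case_prod_unfold)
  also have "\<dots> \<le> (\<Sum>(j, d, e)\<in>K. N * (1 / 3) ^ (j - 1))"
  proof (rule sum_mono, clarify)
    fix j d e assume "(j, d, e) \<in> K"
    then show "real (card (B j d e)) \<le> N * (1 / 3) ^ (j - 1)"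
      by (intro bad) (auto simp: K_def)
  qed
  also have "\<dots> = (\<Sum>j = 1..n div 2. \<Sum>p\<in>{..<j} \<times> {j, n - j}. N * (1 / 3) ^ (j - 1))"
    unfolding K_def by (subst sum.Sigma) (auto simp: case_prod_unfold)
  also have "\<dots> \<le> (\<Sum>j = 1..n div 2. 2 * N * (real j * (1 / 3) ^ (j - 1)))"
  proof (rule sum_mono)
    fix j
    \<comment> \<open>Only an inequality, because the two offsets coincide when n = 2j.\<close>
    have "card ({..<j} \<times> {j, n - j}) \<le> 2 * j"
      by (simp add: card_cartesian_product card_insert_if)
    then have "real (card ({..<j} \<times> {j, n - j})) * (N * (1 / 3) ^ (j - 1)) \<le> real (2 * j) * (N * (1 / 3) ^ (j - 1))"
      by (intro mult_right_mono) (simp_all only: of_nat_le_iff, simp add: N_def)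
    then show "(\<Sum>p\<in>{..<j} \<times> {j, n - j}. N * (1 / 3) ^ (j - 1)) \<le> 2 * N * (real j * (1 / 3) ^ (j - 1))"
      by (simp add: mult_ac)
  qed
  also have "\<dots> = 2 * N * (\<Sum>j = 1..n div 2. real j * (1 / 3) ^ (j - 1))"
    by (simp add: sum_distrib_left)
  also have "\<dots> \<le> 2 * N * (9 / 4)"
    using arithmetic_geometric_third by (intro mult_left_mono) (auto simp: N_def)
  \<comment> \<open>Strictness of 9/2 N < 5 N rests on N > 0, that is, on square-free words on
    \<open>As\<close> existing.\<close>
  also have "\<dots> < 5 * N"
    using nonrep_words_pos[of As] card5 by (simp add: N_def snoc)
  also have "\<dots> = real (card E)" by (simp add: N_def cardE)
  finally have lt: "card (\<Union>(j, d, e)\<in>K. B j d e) < card E" by simp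
  have "\<not> E \<subseteq> (\<Union>(j, d, e)\<in>K. B j d e)"
  proof
    assume "E \<subseteq> (\<Union>(j, d, e)\<in>K. B j d e)"
    moreover have "finite (\<Union>(j, d, e)\<in>K. B j d e)"
      using finK finE by (auto simp: B_def)
    ultimately show False using card_mono lt by (metis not_less)
  qed
  then obtain w where "w \<in> E" "w \<notin> (\<Union>(j, d, e)\<in>K. B j d e)" by blast
  then show ?thesis using cover listE by blast
qed

text \<open>Lists that are larger or infinite are first cut down to five colours, as the counting
  assumes. Vertex i corresponds to position i - 1.\<close>

lemma cyclically_nonrep_colouring_exists:
  assumes "\<And>i. i \<in> {1..n} \<Longrightarrow> infinite (L i) \<or> 5 \<le> card (L i)"
  shows "\<exists>w. length w = n \<and> cyclically_nonrep w \<and> (\<forall>i\<in>{1..n}. w ! (i - 1) \<in> L i)"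
proof -
  have "\<exists>A. A \<subseteq> L i \<and> card A = 5" if "i \<in> {1..n}" for i
    using assms[OF that] infinite_arbitrarily_large[of "L i" 5] obtain_subset_with_card_n[of 5 "L i"]
    by metis
  then obtain A where A: "\<And>i. i \<in> {1..n} \<Longrightarrow> A i \<subseteq> L i \<and> card (A i) = 5"
    by metis
  define Ls where "Ls = map (\<lambda>i. A (Suc i)) [0..<n]"
  have "\<forall>A\<in>set Ls. card A = 5" using A by (auto simp: Ls_def)
  then obtain w where w: "list_all2 (\<in>) w Ls" "cyclically_nonrep w"
    using cyclically_nonrep_word_exists by blast
  have "length w = n" using w(1) by (auto simp: Ls_def dest: list_all2_lengthD)
  moreover have "w ! (i - 1) \<in> L i" if i: "i \<in> {1..n}" for i
  proof -
    have "w ! (i - 1) \<in> Ls ! (i - 1)"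
      using w(1) i \<open>length w = n\<close> by (auto simp: list_all2_conv_all_nth)
    also have "Ls ! (i - 1) = A i" using i by (auto simp: Ls_def)
    finally show ?thesis using A[OF i] by blast
  qed
  ultimately show ?thesis using w(2) by blast
qed

section \<open>Facial paths of the antiprism\<close>

lemma cyclically_nonrep_neq:
  assumes "cyclically_nonrep w" "length w = n" "n \<ge> 3" "i \<in> {1..n}"
  shows "w ! (i - 1) \<noteq> w ! (cyc_suc n i - 1)"
proof -
  have "w ! ((i - 1 + 0) mod n) \<noteq> w ! ((i - 1 + 1 + 0) mod n)"
    using assms(1)[unfolded cyclically_nonrep_def, rule_format, of 1 "i - 1"] assms(2,3) by auto
  then show ?thesis using assms(2-4) by (auto simp: cyc_suc_def split: if_splits)
qed

text \<open>A path running along a cycle reads consecutive cyclic positions of \<open>w\<close>, so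
  a square on it is a cyclic square of \<open>w\<close>. The parameter \<open>V\<close> lets this
  serve both \<open>Pv\<close> and \<open>Pu\<close>.\<close>

lemma not_repetition_ascending:
  assumes w: "cyclically_nonrep w" "length w = n" and \<phi>: "\<And>i. i \<in> {1..n} \<Longrightarrow> \<phi> (V i) = w ! (i - 1)"
    and step: "\<And>k. Suc k < length q \<Longrightarrow> \<exists>i\<in>{1..n}. q ! k = V i \<and> q ! Suc k = V (cyc_suc n i)"
    and V: "inj V" and "distinct q" "n \<ge> 3"
  shows "\<not> repetition (map \<phi> q)"
proof
  assume "repetition (map \<phi> q)"
  then obtain j where j: "j \<ge> 1" "length q = 2 * j"
    and rep: "\<And>i. i < j \<Longrightarrow> \<phi> (q ! i) = \<phi> (q ! (j + i))"
    unfolding repetition_def by auto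
  obtain a where a: "a \<in> {1..n}" "q ! 0 = V a" using step[of 0] j by auto
  \<comment> \<open>Vertices are numbered from 1 and residues from 0, hence the shifts around
    \<open>mod\<close>.\<close>
  have pos: "q ! k = V (Suc ((a - 1 + k) mod n))" if "k < 2 * j" for k
    using that
  proof (induction k)
    case 0
    then show ?case using a by auto
  next
    case (Suc k)
    then obtain i where i: "i \<in> {1..n}" "q ! k = V i" "q ! Suc k = V (cyc_suc n i)"
      using step[of k] j by auto
    then have "i = Suc ((a - 1 + k) mod n)" using Suc V by (auto dest: injD)
    then have "cyc_suc n i = Suc (Suc (a - 1 + k) mod n)"
      by (auto simp: cyc_suc_def mod_Suc)
    then show ?case using i by simp
  qed
  have in_range: "Suc (k mod n) \<in> {1..n}" for k
    using \<open>n \<ge> 3\<close> by (simp add: Suc_le_eq)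
  \<comment> \<open>Distinct vertices cannot go round the cycle more than once. This yields 2j \<le>
    n, the range in which \<open>cyclically_nonrep\<close> speaks.\<close>
  have "set q \<subseteq> V ` {1..n}"
    using pos in_range j(2) by (auto simp: in_set_conv_nth)
  then have "card (set q) \<le> n"
    by (metis card_atLeastAtMost card_image_le card_mono diff_Suc_1 finite_atLeastAtMost finite_imageI le_trans)
  then have "2 * j \<le> n" using \<open>distinct q\<close> j by (simp add: distinct_card)
  then obtain i where i: "i < j" "w ! ((a - 1 + i) mod n) \<noteq> w ! ((a - 1 + j + i) mod n)"
    using w j(1) unfolding cyclically_nonrep_def by blast
  then show False
    using rep[OF i(1)] pos[of i] pos[of "j + i"] \<phi> in_range by (simp add: add.assoc)
qed

lemma fst_face_succ: "fst (face_succ rot e) = snd e"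
  by (simp add: face_succ_def case_prod_unfold)

lemma face_succ_iterate_in:
  assumes "cyclic_on (face_succ rot) F" "a \<in> F"
  shows "(face_succ rot ^^ k) a \<in> F"
  by (induction k) (use assms in \<open>auto simp: cyclic_on_f_in cyclic_on_inI\<close>)

lemma antiprism_facial_nonrepetitive:
  assumes n: "n \<ge> 3"
    and u: "cyclically_nonrep wu" "length wu = n" "\<And>i. i \<in> {1..n} \<Longrightarrow> \<phi> (Pu i) = wu ! (i - 1)"
    and v: "cyclically_nonrep wv" "length wv = n" "\<And>i. i \<in> {1..n} \<Longrightarrow> \<phi> (Pv i) = wv ! (i - 1)"
    and uv: "\<And>i. i \<in> {1..n} \<Longrightarrow> \<phi> (Pv i) \<noteq> \<phi> (Pu i) \<and> \<phi> (Pv i) \<noteq> \<phi> (Pu (cyc_suc n i))"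
  shows "facial_nonrepetitive (antiprism n) (antiprism_rot n) \<phi>"
proof -
  let ?f = "face_succ (antiprism_rot n)"
  have proper: "\<phi> x \<noteq> \<phi> y" if xy_arc: "(x, y) \<in> parcs (antiprism n)" for x y
  proof -
    obtain i where i: "i \<in> {1..n}" and xy: "(x, y) \<in>
      {(Pv i, Pv (cyc_suc n i)), (Pv (cyc_suc n i), Pv i),
       (Pu i, Pu (cyc_suc n i)), (Pu (cyc_suc n i), Pu i), (Pu i, Pv i), (Pv i, Pu i),
       (Pu (cyc_suc n i), Pv i), (Pv i, Pu (cyc_suc n i))}"
      using xy_arc unfolding antiprism_arc_iff[OF n] by (rule bexE)
    have s: "cyc_suc n i \<in> {1..n}" by (rule cyc_suc_in[OF n i])
    have "\<phi> (Pv i) \<noteq> \<phi> (Pv (cyc_suc n i))" "\<phi> (Pu i) \<noteq> \<phi> (Pu (cyc_suc n i))"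
      using cyclically_nonrep_neq[OF u(1,2) n i] cyclically_nonrep_neq[OF v(1,2) n i]
      by (simp_all only: u(3) v(3) i s not_False_eq_True)
    then show ?thesis using xy uv[OF i] by (elim insertE emptyE) auto
  qed
  have walk: "\<not> repetition (map \<phi> q)"
    if a: "a \<in> parcs (antiprism n)" and q: "q = map (\<lambda>k. fst ((?f ^^ k) a)) [0..<m]"
      and dist: "distinct q" for a q m
  proof -
    have len: "length q = m" by (simp add: q)
    have arc: "(q ! k, q ! Suc k) = (?f ^^ k) a" if "Suc k < m" for k
      using that by (simp add: q fst_face_succ)
    \<comment> \<open>At most three distinct vertices leave only period 1, which would be an edge
      with equally coloured ends.\<close>
    have triangle: "\<not> repetition (map \<phi> q)"
      if F: "cyclic_on ?f F" "a \<in> F" and "finite F" "card F \<le> 3" for F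
    proof
      assume "repetition (map \<phi> q)"
      then obtain j where j: "j \<ge> 1" "m = 2 * j" "\<And>i. i < j \<Longrightarrow> \<phi> (q ! i) = \<phi> (q ! (j + i))"
        unfolding repetition_def by (auto simp: len)
      have "set q \<subseteq> fst ` F"
        using face_succ_iterate_in[OF F] by (auto simp: q)
      then have "m \<le> 3"
        using dist len that card_image_le[of F fst] card_mono[of "fst ` F" "set q"]
        by (metis distinct_card finite_imageI le_trans)
      then have "j = 1" using j by simp
      then have "\<phi> (q ! 0) = \<phi> (q ! 1)" "(q ! 0, q ! 1) = a"
        using j(2) j(3)[of 0] arc[of 0] by auto
      then show False using a proper by metis
    qed
    have "a \<in> v_face n \<union> u_face n \<union> (\<Union>i\<in>{1..n}. vvu_face n i \<union> uuv_face n i)"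
      using a parcs_antiprism_faces[OF n] by simp
    then consider "a \<in> v_face n" | "a \<in> u_face n"
      | i where "i \<in> {1..n}" "a \<in> vvu_face n i" | i where "i \<in> {1..n}" "a \<in> uuv_face n i"
      by blast
    then show ?thesis
    proof cases
      case 1
      show ?thesis
      proof (rule not_repetition_ascending[where V = Pv, OF v])
        fix k assume "Suc k < length q"
        then have "(q ! k, q ! Suc k) \<in> v_face n"
          using arc len face_succ_iterate_in[OF cyclic_v_face[OF n] 1] by simp
        then show "\<exists>i\<in>{1..n}. q ! k = Pv i \<and> q ! Suc k = Pv (cyc_suc n i)"
          by (auto simp: v_face_def)
      qed (use dist n in \<open>auto simp: inj_def\<close>)
    next
      case 2
      \<comment> \<open>The boundary walk of this face traverses the \<open>Pu\<close> cycle with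
        decreasing index, so the reversed path is the ascending one.\<close>
      have "\<not> repetition (map \<phi> (rev q))"
      proof (rule not_repetition_ascending[where V = Pu, OF u])
        fix k assume k: "Suc k < length (rev q)"
        define l where "l = m - Suc (Suc k)"
        have l: "Suc l < m" "rev q ! k = q ! Suc l" "rev q ! Suc k = q ! l"
          using k len by (auto simp: l_def rev_nth Suc_diff_Suc)
        then have "(q ! l, q ! Suc l) \<in> u_face n"
          using arc len face_succ_iterate_in[OF cyclic_u_face[OF n] 2] by simp
        then show "\<exists>i\<in>{1..n}. rev q ! k = Pu i \<and> rev q ! Suc k = Pu (cyc_suc n i)"
          unfolding l by (auto simp: u_face_def)
      qed (use dist n in \<open>auto simp: inj_def\<close>)
      then show ?thesis by (simp add: rev_map[symmetric] repetition_rev)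
    next
      case 3
      show ?thesis using cyclic_vvu_face[OF n 3(1)] 3(2)
        by (rule triangle) (simp_all add: vvu_face_def card_insert_if)
    next
      case 4
      show ?thesis using cyclic_uuv_face[OF n 4(1)] 4(2)
        by (rule triangle) (simp_all add: uuv_face_def card_insert_if)
    qed
  qed
  show ?thesis
    unfolding facial_nonrepetitive_def
  proof safe
    fix p assume "facial_path (antiprism n) (antiprism_rot n) p" and rep: "repetition (map \<phi> p)"
    then obtain a q where "distinct p" and a: "a \<in> parcs (antiprism n)" and q: "q \<in> {p, rev p}"
      "q = map (\<lambda>k. fst ((?f ^^ k) a)) [0..<length p]"
      unfolding facial_path_def by (auto simp: vpath_def)
    from q(1) have "distinct q" "repetition (map \<phi> q)"
      using \<open>distinct p\<close> rep by (auto simp: rev_map[symmetric] repetition_rev)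
    then show False using walk[OF a q(2)] by blast
  qed
qed

theorem theorem13:
  fixes n :: nat
  assumes "n \<ge> 3"
  shows "pi_fl (antiprism n) (antiprism_rot n) \<le> 7"
proof -
  have "facial_nonrepetitively_choosable (antiprism n) (antiprism_rot n) 7"
    unfolding facial_nonrepetitively_choosable_def
  proof (intro allI impI)
    fix L :: "antiprism_vertex \<Rightarrow> nat set"
    assume L: "\<forall>v \<in> pverts (antiprism n). L v \<subseteq> {0<..} \<and> (infinite (L v) \<or> 7 \<le> card (L v))"
    have "infinite (L (Pu i)) \<or> 5 \<le> card (L (Pu i))" if "i \<in> {1..n}" for i
      using L that by (force simp: pverts_antiprism)
    from cyclically_nonrep_colouring_exists[of n "\<lambda>i. L (Pu i)", OF this]
    obtain wu where wu: "length wu = n" "cyclically_nonrep wu" "\<forall>i\<in>{1..n}. wu ! (i - 1) \<in> L (Pu i)"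
      by blast
    \<comment> \<open>The removed colours are those of the two neighbours of \<open>Pv i\<close> on
      the other cycle, so at least 7 - 2 = 5 remain.\<close>
    define M where "M i = L (Pv i) - {wu ! (i - 1), wu ! (cyc_suc n i - 1)}" for i
    have "infinite (M i) \<or> 5 \<le> card (M i)" if "i \<in> {1..n}" for i
    proof -
      have "infinite (L (Pv i)) \<or> 7 \<le> card (L (Pv i))"
        using L that by (force simp: pverts_antiprism)
      moreover have "card {wu ! (i - 1), wu ! (cyc_suc n i - 1)} \<le> 2"
        by (simp add: card_insert_if)
      ultimately show ?thesis
        using diff_card_le_card_Diff[of "{wu ! (i - 1), wu ! (cyc_suc n i - 1)}" "L (Pv i)"]
        unfolding M_def by auto
    qed
    from cyclically_nonrep_colouring_exists[of n M, OF this]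
    obtain wv where wv: "length wv = n" "cyclically_nonrep wv" "\<forall>i\<in>{1..n}. wv ! (i - 1) \<in> M i"
      by blast
    define \<phi> where "\<phi> x = (case x of Pv i \<Rightarrow> wv ! (i - 1) | Pu i \<Rightarrow> wu ! (i - 1))" for x
    have "facial_nonrepetitive (antiprism n) (antiprism_rot n) \<phi>"
      by (rule antiprism_facial_nonrepetitive[OF assms wu(2,1) _ wv(2,1)])
        (use wv(3) in \<open>auto simp: \<phi>_def M_def\<close>)
    moreover have "\<forall>v \<in> pverts (antiprism n). \<phi> v \<in> L v"
      using wu(3) wv(3) by (auto simp: pverts_antiprism \<phi>_def M_def)
    ultimately show "\<exists>\<phi>. facial_nonrepetitive (antiprism n) (antiprism_rot n) \<phi> \<and>
        (\<forall>v \<in> pverts (antiprism n). \<phi> v \<in> L v)" by blast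
  qed
  then have "pi_fl (antiprism n) (antiprism_rot n) \<le> enat 7"
    unfolding pi_fl_def by (intro INF_lower) simp
  then show ?thesis by (simp add: numeral_eq_enat)
qed

end
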